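(* Let $f\in\mathcal{A}$ be of the form $f(z)=z-\sum_{n=2}^{\infty}|a_n|z^n$. Then $f\in\mathcal{U}$ if and only if $\sum_{n=2}^{\infty}n|a_n|\leq 1$.
   Context: $\mathbb{D}=\{z\in\mathbb{C}:|z|<1\}$. $\mathcal{A}$ is the set of all analytic functions $f$ in $\mathbb{D}$ whose Taylor expansion at $0$ has the form $f(z)=z+\sum_{n=2}^{\infty}c_nz^n$, $c_n\in\mathbb{C}$. $\mathcal{U}$ is the set of all $f\in\mathcal{A}$ such that $f(z)/z\neq 0$ in $\mathbb{D}$ (the value at $0$ being $1$) and $\left|f'(z)\left(\frac{z}{f(z)}\right)^2-1\right|<1$ for all $z\in\mathbb{D}$. *)

theory Defs
  imports "HOL-Complex_Analysis.Complex_Analysis"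
begin

abbreviation unit_disc :: "complex set" where
  "unit_disc \<equiv> ball 0 1"

definition class_A :: "(complex \<Rightarrow> complex) set" where
  "class_A = {f. f analytic_on unit_disc \<and>
     (\<exists>c. \<forall>z\<in>unit_disc. (\<lambda>n. c (n + 2) * z ^ (n + 2)) sums (f z - z))}"

text \<open>For \<open>f\<close> in \<open>class_A\<close>, the function \<open>f z / z\<close> has a removable singularity at 0 with value 1.
  The case distinction installs that value, since \<open>f 0 / 0 = 0\<close> in HOL.\<close>

definition quotient_by_id :: "(complex \<Rightarrow> complex) \<Rightarrow> complex \<Rightarrow> complex" where
  "quotient_by_id f z = (if z = 0 then 1 else f z / z)"

text \<open>\<open>z / f z\<close> is the reciprocal of \<open>f z / z\<close>, so that it also has value 1 at 0.\<close>

definition class_U :: "(complex \<Rightarrow> complex) set" where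
  "class_U = {f \<in> class_A.
     (\<forall>z\<in>unit_disc. quotient_by_id f z \<noteq> 0) \<and>
     (\<forall>z\<in>unit_disc. cmod (deriv f z * (1 / quotient_by_id f z)\<^sup>2 - 1) < 1)}"

end

theory Submission
  imports Defs
begin

text \<open>
  Write \<open>b\<^sub>n = |a\<^sub>n|\<close> and \<open>g(z) = \<Sum> b\<^sub>n z\<^sup>n\<^sup>-\<^sup>1\<close>, so that \<open>f(z)/z = 1 - g(z)\<close> and
  \<open>f'(z) = 1 - h(z)\<close> with \<open>h(z) = \<Sum> n b\<^sub>n z\<^sup>n\<^sup>-\<^sup>1\<close>, all sums over \<open>n \<ge> 2\<close>.

  Necessity follows from the values on the radius \<open>0 < r < 1\<close>. There \<open>f'(r)\<close> and \<open>f(r)/r\<close> are real, and a real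
  number \<open>f'(r) (r/f(r))\<^sup>2\<close> at distance less than 1 from 1 is positive; hence \<open>f'(r) > 0\<close>, that is,
  \<open>h(r) < 1\<close>. All terms are nonnegative, so letting \<open>r \<rightarrow> 1\<close> bounds every partial sum of
  \<open>\<Sum> n b\<^sub>n\<close> by 1 (lemma \<open>sum_le_one_of_power_series_less_one\<close>).

  For sufficiency, multiply the defining inequality by \<open>|f(z)/z|\<^sup>2\<close>: it becomes
  \<open>|f'(z) - (f(z)/z)\<^sup>2| < |f(z)/z|\<^sup>2\<close>. Here \<open>f' - (f/z)\<^sup>2 = -((h - 2g) + g\<^sup>2)\<close>, and the series
  \<open>h - 2g\<close> has the coefficients \<open>(n - 2) b\<^sub>n \<ge> 0\<close>. With \<open>G = g(|z|)\<close> and \<open>H = h(|z|)\<close> the left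
  side is thus at most \<open>(H - 2G) + G\<^sup>2\<close>, while the right side is at least \<open>(1 - G)\<^sup>2\<close>. The
  difference of these two bounds is exactly \<open>1 - H\<close>, which is positive because
  \<open>H \<le> |z| \<Sum> n b\<^sub>n < 1\<close>.

  In the proofs all series are indexed from 0: there \<open>b n\<close> is the coefficient of \<open>z\<^sup>n\<^sup>+\<^sup>2\<close> in \<open>z - f(z)\<close>.
\<close>

text \<open>Termwise differentiation, with the derivative series again starting at its first
  possibly nonzero coefficient.\<close>

lemma deriv_id_minus_power_series:
  fixes f :: "complex \<Rightarrow> complex" and b :: "nat \<Rightarrow> complex"
  assumes f: "\<And>z. z \<in> unit_disc \<Longrightarrow> (\<lambda>n. b n * z ^ (n + 2)) sums (z - f z)"
    and z: "z \<in> unit_disc"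
  shows "(\<lambda>n. of_nat (n + 2) * b n * z ^ (n + 1)) sums (1 - deriv f z)"
proof -
  define c where "c n = (if n < 2 then 0 else b (n - 2))" for n
  have c_sums: "(\<lambda>n. c n * w ^ n) sums (w - f w)" if "w \<in> unit_disc" for w
  proof -
    have "(\<lambda>n. c (n + 2) * w ^ (n + 2)) sums (w - f w)"
      using f[OF that] by (simp add: c_def)
    then have "(\<lambda>n. c n * w ^ n) sums ((w - f w) + (\<Sum>i<2. c i * w ^ i))"
      by (subst (asm) sums_iff_shift)
    moreover have "(\<Sum>i<2. c i * w ^ i) = 0"
      by (simp add: c_def)
    ultimately show ?thesis by simp
  qed
  have summ: "summable (\<lambda>n. c n * w ^ n)" if "norm w < 1" for w
    using c_sums[of w] that by (auto simp: sums_iff)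
  let ?D = "\<Sum>n. diffs c n * z ^ n"
  have "((\<lambda>w. \<Sum>n. c n * w ^ n) has_field_derivative ?D) (at z)"
    using z summ by (intro termdiffs_strong'[where K = 1]) auto
  then have "((\<lambda>w. w - f w) has_field_derivative ?D) (at z)"
  proof (rule has_field_derivative_transform_within_open)
    show "open unit_disc" "z \<in> unit_disc" using z by auto
    show "(\<Sum>n. c n * w ^ n) = w - f w" if "w \<in> unit_disc" for w
      using c_sums[OF that] by (simp add: sums_iff)
  qed
  then have "((\<lambda>w. w - (w - f w)) has_field_derivative (1 - ?D)) (at z)"
    by (rule DERIV_diff[OF DERIV_ident])
  then have "deriv f z = 1 - ?D"
    by (intro DERIV_imp_deriv) simp
  moreover have "summable (\<lambda>n. diffs c n * z ^ n)"
    using z by (intro termdiff_converges[where K = 1] summ) auto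
  ultimately have D: "(\<lambda>n. diffs c n * z ^ n) sums (1 - deriv f z)"
    by (simp add: sums_iff)
  have "diffs c 0 = 0"
    by (simp add: diffs_def c_def)
  then have "(\<lambda>n. diffs c (Suc n) * z ^ Suc n) sums (1 - deriv f z)"
    using D by (subst sums_Suc_iff) simp
  then show ?thesis
    by (simp add: diffs_def c_def)
qed

text \<open>A converse to Abel's theorem for nonnegative coefficients: each partial sum is dominated by
  the whole series on \<open>(0, 1)\<close> and, being a polynomial, keeps the bound in the limit at 1.\<close>

lemma sum_le_one_of_power_series_less_one:
  fixes b :: "nat \<Rightarrow> real"
  assumes nonneg: "\<And>n. b n \<ge> 0"
    and summ: "\<And>r. 0 < r \<Longrightarrow> r < 1 \<Longrightarrow> summable (\<lambda>n. b n * r ^ (n + 1))"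
    and less: "\<And>r. 0 < r \<Longrightarrow> r < 1 \<Longrightarrow> (\<Sum>n. b n * r ^ (n + 1)) < 1"
  shows "summable b \<and> (\<Sum>n. b n) \<le> 1"
proof -
  have partial: "(\<Sum>n<N. b n) \<le> 1" for N
  proof (rule tendsto_upperbound)
    show "((\<lambda>r. \<Sum>n<N. b n * r ^ (n + 1)) \<longlongrightarrow> (\<Sum>n<N. b n)) (at_left 1)"
      by (rule tendsto_eq_intros refl | simp)+
    show "\<forall>\<^sub>F r in at_left (1::real). (\<Sum>n<N. b n * r ^ (n + 1)) \<le> 1"
    proof (rule eventually_at_leftI[of 0])
      fix r :: real
      assume "r \<in> {0<..<1}"
      then have r: "0 < r" "r < 1" by auto
      have "(\<Sum>n<N. b n * r ^ (n + 1)) \<le> (\<Sum>n. b n * r ^ (n + 1))"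
        using nonneg r by (intro sum_le_suminf summ) auto
      also have "\<dots> < 1" by (rule less[OF r])
      finally show "(\<Sum>n<N. b n * r ^ (n + 1)) \<le> 1" by simp
    qed simp
  qed simp
  have "summable b"
    using nonneg partial by (rule summableI_nonneg_bounded)
  then show ?thesis
    using partial by (auto intro: suminf_le_const)
qed

text \<open>The analytic core of sufficiency, where \<open>g\<close> and \<open>h\<close> stand for \<open>1 - f(z)/z\<close> and
  \<open>1 - f'(z)\<close>. Bounding \<open>h - 2g\<close> through its own coefficients is what makes the triangle
  inequality sharp enough: bounding \<open>h\<close> and \<open>2g\<close> separately would lose \<open>4G\<close>.\<close>

lemma weighted_coefficient_sum_imp_U_inequality:
  fixes b :: "nat \<Rightarrow> real" and z g h :: complex
  assumes nonneg: "\<And>n. b n \<ge> 0"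
    and summ: "summable (\<lambda>n. real (n + 2) * b n)"
    and le1: "(\<Sum>n. real (n + 2) * b n) \<le> 1"
    and z: "norm z < 1"
    and g: "(\<lambda>n. of_real (b n) * z ^ (n + 1)) sums g"
    and h: "(\<lambda>n. of_nat (n + 2) * of_real (b n) * z ^ (n + 1)) sums h"
  shows "1 - g \<noteq> 0" and "cmod ((1 - h) * (1 / (1 - g))\<^sup>2 - 1) < 1"
proof -
  define r where "r = norm z"
  have r: "0 \<le> r" "r < 1" using z by (auto simp: r_def)
  have pow: "r ^ (n + 1) \<le> r" for n
    using r by (simp add: mult_left_le power_le_one)
  have le_r: "real (n + 2) * b n * r ^ (n + 1) \<le> real (n + 2) * b n * r" for n
    using nonneg[of n] pow[of n] by (intro mult_left_mono) auto
  define G where "G = (\<Sum>n. b n * r ^ (n + 1))"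
  define H where "H = (\<Sum>n. real (n + 2) * b n * r ^ (n + 1))"
  have sumH: "summable (\<lambda>n. real (n + 2) * b n * r ^ (n + 1))"
    using nonneg r le_r
    by (intro summable_comparison_test'[OF summable_mult2[OF summ, of r], of 0]) auto
  have sumG: "summable (\<lambda>n. b n * r ^ (n + 1))"
  proof (rule summable_comparison_test'[OF sumH, of 0])
    fix n :: nat
    have "1 * (b n * r ^ (n + 1)) \<le> real (n + 2) * (b n * r ^ (n + 1))"
      using nonneg[of n] r by (intro mult_right_mono) auto
    then show "norm (b n * r ^ (n + 1)) \<le> real (n + 2) * b n * r ^ (n + 1)"
      using nonneg[of n] r by (simp add: mult.assoc)
  qed
  have "H \<le> (\<Sum>n. real (n + 2) * b n * r)"
    unfolding H_def by (intro suminf_le le_r sumH summable_mult2 summ)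
  also have "\<dots> = (\<Sum>n. real (n + 2) * b n) * r"
    by (rule suminf_mult2[OF summ, symmetric])
  also have "\<dots> \<le> r"
    using mult_right_mono[OF le1 r(1)] by simp
  finally have H: "H < 1" using r by simp
  have diff: "(\<lambda>n. real n * b n * r ^ (n + 1)) sums (H - 2 * G)"
    using sums_diff[OF summable_sums[OF sumH] sums_mult[OF summable_sums[OF sumG], of 2]]
    by (simp add: G_def H_def algebra_simps)
  have "0 \<le> H - 2 * G"
    by (rule sums_le[OF _ sums_zero diff]) (use nonneg r in auto)
  then have G: "G < 1" using H by simp
  have norm_g: "norm g \<le> G"
  proof -
    have *: "norm (of_real (b n) * z ^ (n + 1)) = b n * r ^ (n + 1)" for n
      using nonneg[of n] by (simp add: norm_mult norm_power r_def)
    have "norm (\<Sum>n. of_real (b n) * z ^ (n + 1)) \<le> (\<Sum>n. b n * r ^ (n + 1))"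
      unfolding *[symmetric] by (rule summable_norm) (use sumG in \<open>simp only: *\<close>)
    then show ?thesis using g by (simp add: sums_iff G_def)
  qed
  have norm_h: "norm (h - 2 * g) \<le> H - 2 * G"
  proof -
    have *: "norm (of_nat n * of_real (b n) * z ^ (n + 1)) = real n * b n * r ^ (n + 1)" for n
      using nonneg[of n] by (simp add: norm_mult norm_power r_def)
    have "norm (\<Sum>n. of_nat n * of_real (b n) * z ^ (n + 1)) \<le> (\<Sum>n. real n * b n * r ^ (n + 1))"
      unfolding *[symmetric] by (rule summable_norm) (use diff in \<open>simp only: * sums_iff\<close>)
    moreover have "(\<lambda>n. of_nat n * of_real (b n) * z ^ (n + 1)) sums (h - 2 * g)"
      using sums_diff[OF h sums_mult[OF g, of 2]] by (simp add: algebra_simps)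
    ultimately show ?thesis using diff by (simp add: sums_iff)
  qed
  have lower: "1 - G \<le> norm (1 - g)"
    using norm_triangle_ineq2[of 1 g] norm_g by simp
  then show nz: "1 - g \<noteq> 0" using G by auto
  have "norm ((1 - h) - (1 - g)\<^sup>2) = norm ((h - 2 * g) + g\<^sup>2)"
    by (subst norm_minus_cancel[symmetric]) (simp add: power2_eq_square algebra_simps)
  also have "\<dots> \<le> norm (h - 2 * g) + (norm g)\<^sup>2"
    using norm_triangle_ineq[of "h - 2 * g" "g\<^sup>2"] by (simp add: norm_power)
  also have "\<dots> \<le> (H - 2 * G) + G\<^sup>2"
    using norm_h norm_g by (intro add_mono power_mono) auto
  also have "\<dots> < (1 - G)\<^sup>2"
    using H by (simp add: power2_eq_square algebra_simps)
  also have "\<dots> \<le> (norm (1 - g))\<^sup>2"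
    using lower G by (intro power_mono) auto
  finally have main: "norm ((1 - h) - (1 - g)\<^sup>2) < (norm (1 - g))\<^sup>2" .
  have "(1 - h) * (1 / (1 - g))\<^sup>2 - 1 = ((1 - h) - (1 - g)\<^sup>2) / (1 - g)\<^sup>2"
    using nz by (simp add: power_divide diff_divide_distrib)
  then show "cmod ((1 - h) * (1 / (1 - g))\<^sup>2 - 1) < 1"
    using main nz by (simp add: norm_divide norm_power divide_less_eq)
qed

theorem theorem2:
  fixes f :: "complex \<Rightarrow> complex" and a :: "nat \<Rightarrow> complex"
  assumes "f \<in> class_A"
    and "\<forall>z\<in>unit_disc. (\<lambda>n. complex_of_real (cmod (a (n + 2))) * z ^ (n + 2)) sums (z - f z)"
  shows "f \<in> class_U \<longleftrightarrow>
    summable (\<lambda>n. real (n + 2) * cmod (a (n + 2))) \<and>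
    (\<Sum>n. real (n + 2) * cmod (a (n + 2))) \<le> 1"
proof -
  define b where "b n = cmod (a (n + 2))" for n
  have nonneg: "b n \<ge> 0" for n by (simp add: b_def)
  have f_sums: "(\<lambda>n. of_real (b n) * z ^ (n + 2)) sums (z - f z)" if "z \<in> unit_disc" for z
    using assms(2) that by (simp add: b_def)
  have h_sums: "(\<lambda>n. of_nat (n + 2) * of_real (b n) * z ^ (n + 1)) sums (1 - deriv f z)"
    if "z \<in> unit_disc" for z
    using f_sums that by (rule deriv_id_minus_power_series)
  have g_sums: "(\<lambda>n. of_real (b n) * z ^ (n + 1)) sums (1 - quotient_by_id f z)"
    if z: "z \<in> unit_disc" for z
  proof (cases "z = 0")
    case True
    then show ?thesis by (simp add: quotient_by_id_def)
  next
    case False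
    then show ?thesis
      using sums_divide[OF f_sums[OF z], of z]
      by (simp add: quotient_by_id_def diff_divide_distrib)
  qed
  show ?thesis
    unfolding b_def[symmetric]
  proof
    assume U: "f \<in> class_U"
    have real_h: "summable (\<lambda>n. real (n + 2) * b n * r ^ (n + 1)) \<and>
        (\<Sum>n. real (n + 2) * b n * r ^ (n + 1)) < 1" if r: "0 < r" "r < 1" for r
    proof -
      let ?z = "complex_of_real r"
      have z: "?z \<in> unit_disc" using r by simp
      define q where "q = Re (quotient_by_id f ?z)"
      have "(\<lambda>n. complex_of_real (real (n + 2) * b n * r ^ (n + 1))) sums (1 - deriv f ?z)"
        using h_sums[OF z] by simp
      note h = sums_Re[OF this] sums_Im[OF this]
      have "(\<lambda>n. complex_of_real (b n * r ^ (n + 1))) sums (1 - quotient_by_id f ?z)"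
        using g_sums[OF z] by simp
      note sums_Im[OF this]
      then have "quotient_by_id f ?z = of_real q"
        by (simp add: complex_eq_iff q_def sums_iff)
      moreover define d where "d = Re (deriv f ?z)"
      have "deriv f ?z = of_real d"
        using h(2) by (simp add: complex_eq_iff d_def sums_iff)
      moreover have "cmod (deriv f ?z * (1 / quotient_by_id f ?z)\<^sup>2 - 1) < 1"
        using U z by (simp add: class_U_def)
      ultimately have "cmod (of_real (d * (1 / q)\<^sup>2 - 1)) < 1"
        by simp
      then have "\<bar>d * (1 / q)\<^sup>2 - 1\<bar> < 1"
        by (simp only: norm_of_real)
      then have "0 < d * (1 / q)\<^sup>2" by linarith
      then have "0 < d"
        by (metis linorder_not_less mult_nonpos_nonneg zero_le_power2)
      then show ?thesis using h(1) by (simp add: sums_iff d_def)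
    qed
    show "summable (\<lambda>n. real (n + 2) * b n) \<and> (\<Sum>n. real (n + 2) * b n) \<le> 1"
      using nonneg real_h by (intro sum_le_one_of_power_series_less_one) auto
  next
    assume S: "summable (\<lambda>n. real (n + 2) * b n) \<and> (\<Sum>n. real (n + 2) * b n) \<le> 1"
    have "quotient_by_id f z \<noteq> 0 \<and> cmod (deriv f z * (1 / quotient_by_id f z)\<^sup>2 - 1) < 1"
      if z: "z \<in> unit_disc" for z
      using weighted_coefficient_sum_imp_U_inequality
              [OF nonneg conjunct1[OF S] conjunct2[OF S] _ g_sums[OF z] h_sums[OF z]] z
      by simp
    then show "f \<in> class_U"
      using assms(1) by (auto simp: class_U_def)
  qed
qed

end
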